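(* Let $S$ be an admissible pinnacle set and let $\mathcal{A}$ be an ordering of the elements of $S$. Then $\mathcal{A}$ is an admissible ordering of $S$ if and only if, for each $x \in S$, the set $S_x = [1,x]\cap S$ is interrupted at most $k_x := |\overline{S}_x| - |S_x| - 1$ times in $\mathcal{A}$, where $\overline{S}_x = [1,x]\setminus S$.
   Context: A permutation $w = w(1)w(2)\cdots w(n)$ of $[n]$ has a pinnacle $w(i)$ whenever $i \in [2,n-1]$ and $w(i-1) < w(i) > w(i+1)$; $\mathrm{Pin}(w)$ denotes the set of pinnacles. A set $S$ of positive integers is an admissible pinnacle set if $S = \mathrm{Pin}(w)$ for some permutation $w$ (of some $[n]$). An ordering of $S$ is admissible if there is a permutation $w$ with $\mathrm{Pin}(w)=S$ whose pinnacles appear (left to right in $w$) in that order. For $x$ a positive integer, $S_x := [1,x]\cap S$ and $\overline{S}_x := [1,x]\setminus S$. Interruption: given a subset $T \subseteq S$ and an ordering $\mathcal{A}$ of $S$, write $\mathcal{A}$ as a word $a_0 t_1 a_1 t_2 \cdots a_{k-1} t_k a_k$ where each $t_i$ is a nonempty word of elements of $T$, each $a_i$ is a word of elements of $S\setminus T$, and only $a_0$ and $a_k$ may be empty; then $T$ is interrupted $k-1$ times in $\mathcal{A}$ (uninterrupted if $k=1$). *)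

theory Defs
  imports "HOL-Combinatorics.Multiset_Permutations"
begin

(* Permutations of [n] are words, i.e. elements of permutations_of_set {1..n}.
   List positions are 0-based, so the positions 2, ..., n-1 are the i with 0 < i < n - 1. *)

definition Pin :: "nat list \<Rightarrow> nat set" where
  "Pin w = {w ! i |i. 0 < i \<and> i + 1 < length w \<and> w ! (i - 1) < w ! i \<and> w ! i > w ! (i + 1)}"

definition admissible_pinnacle_set :: "nat set \<Rightarrow> bool" where
  "admissible_pinnacle_set S \<longleftrightarrow> (\<exists>n. \<exists>w \<in> permutations_of_set {1..n}. Pin w = S)"

definition admissible_ordering :: "nat set \<Rightarrow> nat list \<Rightarrow> bool" where
  "admissible_ordering S A \<longleftrightarrow>
     (\<exists>n. \<exists>w \<in> permutations_of_set {1..n}. Pin w = S \<and> filter (\<lambda>y. y \<in> Pin w) w = A)"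

definition below :: "nat set \<Rightarrow> nat \<Rightarrow> nat set" where
  "below S x = {1..x} \<inter> S"

definition cobelow :: "nat set \<Rightarrow> nat \<Rightarrow> nat set" where
  "cobelow S x = {1..x} - S"

(* T is interrupted m times in the word A: A = a 0 t 1 a 1 ... t k (a k) with k = m + 1,
   where set A is the ordered set S. The relation holds for no m if T does not meet set A. *)
definition interrupted_times :: "'a set \<Rightarrow> 'a list \<Rightarrow> nat \<Rightarrow> bool" where
  "interrupted_times T A m \<longleftrightarrow>
     (\<exists>k a t. k = m + 1 \<and>
        A = a 0 @ concat (map (\<lambda>i. t i @ a i) [1..<k + 1]) \<and>
        (\<forall>i \<in> {1..k}. t i \<noteq> [] \<and> set (t i) \<subseteq> T) \<and>
        (\<forall>i \<in> {0..k}. set (a i) \<subseteq> set A - T) \<and>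
        (\<forall>i \<in> {1..<k}. a i \<noteq> []))"

definition interrupted_at_most :: "'a set \<Rightarrow> 'a list \<Rightarrow> int \<Rightarrow> bool" where
  "interrupted_at_most T A b \<longleftrightarrow> (\<exists>m. interrupted_times T A m \<and> int m \<le> b)"

definition k_bound :: "nat set \<Rightarrow> nat \<Rightarrow> int" where
  "k_bound S x = int (card (cobelow S x)) - int (card (below S x)) - 1"

end

theory Submission
  imports Defs
begin

text \<open>
  An ordering \<open>s\<^sub>1 \<dots> s\<^sub>p\<close> of \<open>S\<close> has \<open>p + 1\<close> gaps, the two outer ones included, and each gap of a
  witnessing permutation must contain a non-pinnacle below both adjacent pinnacles. Conversely,
  distinct elements of the complement of \<open>S\<close> satisfying these bounds give a permutation: put them
  into the gaps and sort all remaining non-pinnacles decreasingly together with the first of them.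
  Since the bounds cut out initial segments, Hall's condition says that, for each \<open>x \<in> S\<close>, at most
  \<open>|[1,x] - S|\<close> gaps are adjacent to an element of \<open>S\<^sub>x\<close>. A maximal run of \<open>l\<close> elements of \<open>S\<^sub>x\<close> touches
  \<open>l + 1\<close> gaps and distinct runs touch distinct gaps, so this number is \<open>|S\<^sub>x|\<close> plus the number of
  runs, which is one more than the number of interruptions.
\<close>

section \<open>Gaps and interruptions\<close>

text \<open>The number of gaps of \<open>A\<close> next to an element satisfying \<open>P\<close>, where the flag \<open>c\<close> tells whether
  an element preceding \<open>A\<close> satisfies \<open>P\<close>.\<close>

fun gap_count :: "('a \<Rightarrow> bool) \<Rightarrow> bool \<Rightarrow> 'a list \<Rightarrow> nat" where
  "gap_count P c [] = of_bool c"
| "gap_count P c (s # A) = of_bool (c \<or> P s) + gap_count P (P s) A"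

lemma gap_count_cong:
  "(\<And>s. s \<in> set A \<Longrightarrow> P s = Q s) \<Longrightarrow> gap_count P c A = gap_count Q c A"
  by (induction A arbitrary: c) auto

lemma gap_count_False_le: "gap_count P False A \<le> gap_count P c A"
  by (cases A) auto

lemma gap_count_le_Suc: "gap_count P c A \<le> Suc (gap_count P d A)"
  by (cases A) auto

text \<open>With \<open>u\<close> empty and \<open>c\<close> true, the gap before \<open>A\<close>
  could be counted twice; the side condition excludes this.\<close>

lemma gap_count_append_neg:
  assumes "\<forall>s \<in> set u. \<not> P s" and "u \<noteq> [] \<or> \<not> c"
  shows "gap_count P c (u @ A) = of_bool c + gap_count P False A"
  using assms by (induction u arbitrary: c) auto

lemma gap_count_append_pos:
  assumes "\<forall>s \<in> set u. P s" and "u \<noteq> [] \<or> c"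
  shows "gap_count P c (u @ A) = length u + gap_count P True A"
  using assms by (induction u arbitrary: c) auto

text \<open>Each run \<open>t i\<close> accounts for the gap before each of its letters and one gap
  after it. The last separator \<open>a k\<close> may be empty, since the end of the word closes the
  final gap.\<close>

lemma gap_count_blocks:
  assumes "j \<le> k"
    and "\<forall>i \<in> {j..k}. t i \<noteq> [] \<and> (\<forall>s \<in> set (t i). P s) \<and> (\<forall>s \<in> set (a i). \<not> P s)"
    and "\<forall>i \<in> {j..<k}. a i \<noteq> []"
  defines "A \<equiv> concat (map (\<lambda>i. t i @ a i) [j..<Suc k])"
  shows "gap_count P False A = length (filter P A) + (Suc k - j)"
  using assms(1-3) unfolding A_def
proof (induction rule: inc_induct)
  case base
  have t: "t k \<noteq> []" "\<forall>s \<in> set (t k). P s" and a: "\<forall>s \<in> set (a k). \<not> P s"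
    using base by auto
  have "gap_count P True (a k) = 1"
    using gap_count_append_neg[of "a k" P True "[]"] a by (cases "a k") auto
  then show ?case
    using t a by (simp add: gap_count_append_pos)
next
  case (step j)
  let ?B = "concat (map (\<lambda>i. t i @ a i) [Suc j..<Suc k])"
  have t: "t j \<noteq> []" "\<forall>s \<in> set (t j). P s" and a: "\<forall>s \<in> set (a j). \<not> P s" "a j \<noteq> []"
    using step.prems step.hyps by auto
  have IH: "gap_count P False ?B = length (filter P ?B) + (Suc k - Suc j)"
    by (rule step.IH) (use step.prems step.hyps in auto)
  have *: "concat (map (\<lambda>i. t i @ a i) [j..<Suc k]) = t j @ a j @ ?B"
    using step.hyps by (simp add: upt_conv_Cons del: upt_Suc)
  have "gap_count P False (t j @ a j @ ?B) = length (t j) + (1 + gap_count P False ?B)"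
    using t a by (simp add: gap_count_append_pos gap_count_append_neg del: upt_Suc)
  moreover have "length (filter P (t j @ a j @ ?B)) = length (t j) + length (filter P ?B)"
    using t a by (simp del: upt_Suc)
  ultimately show ?case
    unfolding * using IH step.hyps by linarith
qed

text \<open>There are \<open>m + 1\<close> runs, each with one gap more than letters. In particular
  \<open>m\<close> is unique.\<close>

lemma gap_count_interrupted_times:
  assumes "interrupted_times T A m"
  shows "gap_count (\<lambda>s. s \<in> T) False A = length (filter (\<lambda>s. s \<in> T) A) + m + 1"
proof -
  obtain k a t where k: "k = m + 1" and A: "A = a 0 @ concat (map (\<lambda>i. t i @ a i) [1..<k + 1])"
    and t: "\<forall>i \<in> {1..k}. t i \<noteq> [] \<and> set (t i) \<subseteq> T"
    and a: "\<forall>i \<in> {0..k}. set (a i) \<subseteq> set A - T"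
    and ne: "\<forall>i \<in> {1..<k}. a i \<noteq> []"
    using assms unfolding interrupted_times_def by (elim exE conjE) (rule that)
  let ?B = "concat (map (\<lambda>i. t i @ a i) [1..<Suc k])"
  have A': "A = a 0 @ ?B"
    using A by (simp only: Suc_eq_plus1)
  have "gap_count (\<lambda>s. s \<in> T) False ?B = length (filter (\<lambda>s. s \<in> T) ?B) + (Suc k - 1)"
    by (rule gap_count_blocks) (use k t a ne in auto)
  moreover have "\<forall>s \<in> set (a 0). s \<notin> T"
    using a by auto
  then have "gap_count (\<lambda>s. s \<in> T) False (a 0 @ ?B) = gap_count (\<lambda>s. s \<in> T) False ?B"
    and "filter (\<lambda>s. s \<in> T) (a 0 @ ?B) = filter (\<lambda>s. s \<in> T) ?B"
    by (simp_all add: gap_count_append_neg del: upt_Suc)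
  ultimately show ?thesis
    using k unfolding A'[symmetric] by simp
qed

text \<open>Split off the first maximal run and recurse on the rest. A list of pairs, run and
  following separator, suits this recursion.\<close>

lemma ex_blocks:
  assumes "\<exists>s \<in> set A. s \<in> T"
  shows "\<exists>a0 ps. A = a0 @ concat (map (\<lambda>(t, a). t @ a) ps) \<and> ps \<noteq> [] \<and> set a0 \<inter> T = {} \<and>
    (\<forall>(t, a) \<in> set ps. t \<noteq> [] \<and> set t \<subseteq> T \<and> set a \<inter> T = {}) \<and>
    (\<forall>(t, a) \<in> set (butlast ps). a \<noteq> [])"
  using assms
proof (induction "length A" arbitrary: A rule: less_induct)
  case less
  define a0 where "a0 = takeWhile (\<lambda>s. s \<notin> T) A"
  define B where "B = dropWhile (\<lambda>s. s \<notin> T) A"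
  define t where "t = takeWhile (\<lambda>s. s \<in> T) B"
  define C where "C = dropWhile (\<lambda>s. s \<in> T) B"
  have A: "A = a0 @ B" and B: "B = t @ C"
    by (auto simp: a0_def B_def t_def C_def)
  have a0: "set a0 \<inter> T = {}" and t: "set t \<subseteq> T"
    by (auto simp: a0_def t_def dest: set_takeWhileD)
  have "B \<noteq> []" "hd B \<in> T"
    using less.prems hd_dropWhile[of "\<lambda>s. s \<notin> T" A] by (auto simp: B_def dropWhile_eq_Nil_conv)
  then have tne: "t \<noteq> []"
    by (cases B) (auto simp: t_def)
  show ?case
  proof (cases "\<exists>s \<in> set C. s \<in> T")
    case False
    then show ?thesis
      using A B a0 t tne by (intro exI[of _ a0] exI[of _ "[(t, C)]"]) auto
  next
    case True
    have "length C < length A"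
      using A B tne by simp
    from less.hyps[OF this True] obtain a1 ps where C: "C = a1 @ concat (map (\<lambda>(t, a). t @ a) ps)"
      and ps: "ps \<noteq> []" "set a1 \<inter> T = {}"
        "\<forall>(t, a) \<in> set ps. t \<noteq> [] \<and> set t \<subseteq> T \<and> set a \<inter> T = {}"
        "\<forall>(t, a) \<in> set (butlast ps). a \<noteq> []"
      by blast
    have "C \<noteq> []"
      using True by auto
    moreover from this have "hd C \<notin> T"
      unfolding C_def by (rule hd_dropWhile)
    \<comment> \<open>With \<open>a1\<close> empty, \<open>C\<close> would begin with a run in
      \<open>T\<close>, against the maximality of \<open>t\<close>. So the separator after
      \<open>t\<close> is nonempty.\<close>
    moreover have "hd C \<in> T" if "a1 = []"
      using that C ps by (cases ps; cases "fst (hd ps)") auto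
    ultimately have "a1 \<noteq> []"
      by blast
    then show ?thesis
      using A B C ps a0 t tne by (intro exI[of _ a0] exI[of _ "(t, a1) # ps"]) auto
  qed
qed

lemma ex_interrupted_times:
  assumes "\<exists>s \<in> set A. s \<in> T"
  shows "\<exists>m. interrupted_times T A m"
proof -
  obtain a0 ps where A: "A = a0 @ concat (map (\<lambda>(t, a). t @ a) ps)"
    and ps: "ps \<noteq> []" "set a0 \<inter> T = {}"
      "\<forall>(t, a) \<in> set ps. t \<noteq> [] \<and> set t \<subseteq> T \<and> set a \<inter> T = {}"
      "\<forall>(t, a) \<in> set (butlast ps). a \<noteq> []"
    using ex_blocks[OF assms] by blast
  \<comment> \<open>Runs are numbered from 1, list positions from 0; index 0 is kept for the initial
    separator.\<close>
  define t where "t i = fst (ps ! (i - 1))" for i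
  define a where "a i = (if i = 0 then a0 else snd (ps ! (i - 1)))" for i
  have map_eq: "map (\<lambda>i. t i @ a i) [1..<length ps + 1] = map (\<lambda>(t, a). t @ a) ps"
    by (rule nth_equalityI) (auto simp: t_def a_def case_prod_unfold nth_append simp del: upt_Suc)
  have block: "t i \<noteq> [] \<and> set (t i) \<subseteq> T \<and> set (a i) \<inter> T = {} \<and> set (a i) \<subseteq> set A"
    if "i \<in> {1..length ps}" for i
  proof -
    have "(t i, a i) = ps ! (i - 1)" "i - 1 < length ps"
      using that by (auto simp: t_def a_def)
    then have "(t i, a i) \<in> set ps"
      by (metis nth_mem)
    moreover from this have "set (a i) \<subseteq> set A"
      unfolding A by auto
    ultimately show ?thesis
      using ps(3) by auto
  qed
  have ne: "a i \<noteq> []" if "i \<in> {1..<length ps}" for i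
  proof -
    have "(t i, a i) = butlast ps ! (i - 1)" "i - 1 < length (butlast ps)"
      using that by (auto simp: t_def a_def nth_butlast)
    then have "(t i, a i) \<in> set (butlast ps)"
      by (metis nth_mem)
    then show ?thesis
      using ps(4) by auto
  qed
  have "set (a i) \<subseteq> set A - T" if "i \<in> {0..length ps}" for i
    using block[of i] that ps(2) A by (cases "i = 0") (auto simp: a_def)
  moreover have "A = a 0 @ concat (map (\<lambda>i. t i @ a i) [1..<length ps + 1])"
    unfolding map_eq by (simp add: A a_def)
  ultimately have "interrupted_times T A (length ps - 1)"
    unfolding interrupted_times_def using block ne ps(1)
    by (intro exI[of _ "length ps"] exI[of _ a] exI[of _ t]) auto
  then show ?thesis ..
qed

lemma interrupted_at_most_iff_gap_count:
  assumes "\<exists>s \<in> set A. s \<in> T"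
  shows "interrupted_at_most T A b \<longleftrightarrow>
    int (gap_count (\<lambda>s. s \<in> T) False A) \<le> int (length (filter (\<lambda>s. s \<in> T) A)) + 1 + b"
proof -
  obtain m where m: "interrupted_times T A m"
    using ex_interrupted_times[OF assms] ..
  have "m' = m" if "interrupted_times T A m'" for m'
    using gap_count_interrupted_times[OF that] gap_count_interrupted_times[OF m] by simp
  then have "interrupted_at_most T A b \<longleftrightarrow> int m \<le> b"
    using m unfolding interrupted_at_most_def by blast
  then show ?thesis
    using gap_count_interrupted_times[OF m] by simp
qed

text \<open>As 0 is not in \<open>S\<close>, \<open>below S x\<close> and the test
  \<open>s \<le> x\<close> agree on \<open>A\<close>; the summand
  \<open>card (below S x) + 1\<close> then cancels against \<open>k_bound S x\<close>.\<close>

lemma interrupted_iff_gap_count: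
  assumes "0 \<notin> S" and A: "A \<in> permutations_of_set S" and x: "x \<in> S"
  shows "interrupted_at_most (below S x) A (k_bound S x) \<longleftrightarrow>
    gap_count (\<lambda>s. s \<le> x) False A \<le> card (cobelow S x)"
proof -
  have set: "set A = S" and dist: "distinct A"
    using A by (auto simp: permutations_of_set_def)
  have pos: "1 \<le> s" if "s \<in> S" for s
    using that assms(1) by (cases s) auto
  then have "\<exists>s \<in> set A. s \<in> below S x"
    using x set by (auto simp: below_def)
  moreover have "length (filter (\<lambda>s. s \<in> below S x) A) = card (below S x)"
    using dist set by (subst distinct_length_filter) (auto simp: below_def intro: arg_cong[of _ _ card])
  moreover have "gap_count (\<lambda>s. s \<in> below S x) False A = gap_count (\<lambda>s. s \<le> x) False A"
    by (rule gap_count_cong) (use pos set in \<open>auto simp: below_def\<close>)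
  ultimately show ?thesis
    by (simp add: interrupted_at_most_iff_gap_count k_bound_def)
qed

section \<open>Pinnacles of words\<close>

text \<open>A new first letter can only turn the old first position into a pinnacle, so pinnacles
  can be computed by recursion.\<close>

lemma Pin_Cons2:
  "Pin (a # b # w) =
    (if a < b \<and> w \<noteq> [] \<and> hd w < b then insert b (Pin (b # w)) else Pin (b # w))"
proof -
  have "Pin (a # b # w) = {y. y = b \<and> a < b \<and> w \<noteq> [] \<and> hd w < b} \<union> Pin (b # w)"
  proof (intro equalityI subsetI)
    fix y assume "y \<in> Pin (a # b # w)"
    then obtain i where i: "y = (a # b # w) ! i" "0 < i" "i + 1 < length (a # b # w)"
      "(a # b # w) ! (i - 1) < (a # b # w) ! i" "(a # b # w) ! i > (a # b # w) ! (i + 1)"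
      unfolding Pin_def by blast
    show "y \<in> {y. y = b \<and> a < b \<and> w \<noteq> [] \<and> hd w < b} \<union> Pin (b # w)"
    proof (cases "i = 1")
      case True
      then show ?thesis
        using i by (cases w) auto
    next
      case False
      then obtain j where "i = Suc (Suc j)"
        using i(2) by (cases i; cases "i - 1") auto
      then have "y \<in> Pin (b # w)"
        unfolding Pin_def using i by (intro CollectI exI[of _ "Suc j"]) auto
      then show ?thesis ..
    qed
  next
    fix y assume "y \<in> {y. y = b \<and> a < b \<and> w \<noteq> [] \<and> hd w < b} \<union> Pin (b # w)"
    then show "y \<in> Pin (a # b # w)"
    proof
      assume "y \<in> {y. y = b \<and> a < b \<and> w \<noteq> [] \<and> hd w < b}"
      then show ?thesis
        unfolding Pin_def by (intro CollectI exI[of _ 1]) (cases w; auto)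
    next
      assume "y \<in> Pin (b # w)"
      then obtain i where i: "y = (b # w) ! i" "0 < i" "i + 1 < length (b # w)"
        "(b # w) ! (i - 1) < (b # w) ! i" "(b # w) ! i > (b # w) ! (i + 1)"
        unfolding Pin_def by blast
      then show ?thesis
        unfolding Pin_def by (intro CollectI exI[of _ "Suc i"]) (cases i; auto)
    qed
  qed
  then show ?thesis
    by auto
qed

lemma Pin_singleton: "Pin [a] = {}"
  by (auto simp: Pin_def)

lemma Pin_subset_set: "Pin w \<subseteq> set w"
  by (auto simp: Pin_def)

text \<open>Distinctness ties each value to a single position.\<close>

lemma nth_in_Pin_iff:
  assumes "distinct w" and "i < length w"
  shows "w ! i \<in> Pin w \<longleftrightarrow>
    0 < i \<and> i + 1 < length w \<and> w ! (i - 1) < w ! i \<and> w ! (i + 1) < w ! i"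
  using assms by (auto simp: Pin_def nth_eq_iff_index_eq)

text \<open>For fixed \<open>S\<close>, this local condition passes to suffixes of a word, unlike
  \<open>Pin w = S\<close>; the induction on words relies on that.\<close>

definition pin_adjacent :: "nat set \<Rightarrow> nat \<Rightarrow> nat \<Rightarrow> bool" where
  "pin_adjacent S a b \<longleftrightarrow> (a \<in> S \<longrightarrow> b \<notin> S \<and> b < a) \<and> (b \<in> S \<longrightarrow> a \<notin> S \<and> a < b)"

lemma successively_pin_adjacent:
  assumes "distinct w"
  shows "successively (pin_adjacent (Pin w)) w"
  unfolding successively_conv_nth pin_adjacent_def
  by (auto simp: nth_in_Pin_iff[OF assms] dest: order.asym)

text \<open>The neighbours of a pinnacle \<open>s \<le> x\<close> are non-pinnacles \<open>\<le> x\<close>, so every gap next to such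
  an \<open>s\<close> contributes to the right-hand side.\<close>

lemma gap_count_le_length_filter:
  assumes "successively (pin_adjacent S) w" and "w \<noteq> []" and "hd w \<notin> S" and "last w \<notin> S"
  shows "gap_count (\<lambda>s. s \<le> x) (hd w \<le> x) (filter (\<lambda>y. y \<in> S) w)
    \<le> length (filter (\<lambda>y. y \<notin> S \<and> y \<le> x) w)"
  using assms
proof (induction "length w" arbitrary: w rule: less_induct)
  case less
  obtain v u where w: "w = v # u"
    using less.prems(2) by (cases w) auto
  show ?case
  proof (cases u)
    case Nil
    then show ?thesis
      using w less.prems by simp
  next
    case (Cons s u')
    show ?thesis
    proof (cases "s \<in> S")
      case False
      have "gap_count (\<lambda>s. s \<le> x) (hd u \<le> x) (filter (\<lambda>y. y \<in> S) u)
        \<le> length (filter (\<lambda>y. y \<notin> S \<and> y \<le> x) u)"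
        by (rule less.hyps) (use less.prems w Cons False in auto)
      \<comment> \<open>Changing the flag costs at most one, and only if \<open>v \<le> x\<close>;
        then \<open>v\<close> itself pays for it.\<close>
      moreover have "gap_count (\<lambda>s. s \<le> x) (v \<le> x) (filter (\<lambda>y. y \<in> S) u)
        \<le> of_bool (v \<le> x) + gap_count (\<lambda>s. s \<le> x) (hd u \<le> x) (filter (\<lambda>y. y \<in> S) u)"
        using gap_count_False_le gap_count_le_Suc by (cases "v \<le> x") auto
      ultimately show ?thesis
        using w less.prems by (cases "v \<le> x") auto
    next
      case True
      then obtain v' u'' where u': "u' = v' # u''"
        using less.prems w Cons by (cases u') auto
      have adj: "v < s" "v' < s" "v' \<notin> S"
        using less.prems(1) w Cons u' True by (auto simp: pin_adjacent_def)
      have "gap_count (\<lambda>s. s \<le> x) (hd u' \<le> x) (filter (\<lambda>y. y \<in> S) u')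
        \<le> length (filter (\<lambda>y. y \<notin> S \<and> y \<le> x) u')"
        by (rule less.hyps) (use less.prems w Cons u' adj in auto)
      \<comment> \<open>As \<open>v' < s\<close>, a true flag \<open>s \<le> x\<close> remains true
        when \<open>v'\<close> replaces \<open>s\<close>.\<close>
      moreover have "gap_count (\<lambda>s. s \<le> x) (s \<le> x) (filter (\<lambda>y. y \<in> S) u')
        \<le> gap_count (\<lambda>s. s \<le> x) (hd u' \<le> x) (filter (\<lambda>y. y \<in> S) u')"
        using adj u' gap_count_False_le by (cases "s \<le> x") auto
      moreover have "v \<notin> S"
        using less.prems w by simp
      ultimately show ?thesis
        using w Cons True adj by (cases "s \<le> x"; cases "v \<le> x") auto
    qed
  qed
qed

lemma gap_count_le_card_cobelow:
  assumes w: "w \<in> permutations_of_set {1..n}" and S: "Pin w = S" "S \<noteq> {}"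
  shows "gap_count (\<lambda>s. s \<le> x) False (filter (\<lambda>y. y \<in> S) w) \<le> card (cobelow S x)"
proof -
  have set: "set w = {1..n}" and dist: "distinct w"
    using w by (auto simp: permutations_of_set_def)
  have ne: "w \<noteq> []"
    using S by (auto simp: Pin_def)
  then have "hd w \<notin> S" "last w \<notin> S"
    using S nth_in_Pin_iff[OF dist, of 0] nth_in_Pin_iff[OF dist, of "length w - 1"]
    by (auto simp: hd_conv_nth last_conv_nth)
  then have "gap_count (\<lambda>s. s \<le> x) (hd w \<le> x) (filter (\<lambda>y. y \<in> S) w)
      \<le> length (filter (\<lambda>y. y \<notin> S \<and> y \<le> x) w)"
    using gap_count_le_length_filter[of S w] successively_pin_adjacent[OF dist] ne S by blast
  also have "\<dots> = card ({y. y \<notin> S \<and> y \<le> x} \<inter> set w)"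
    by (rule distinct_length_filter[OF dist])
  also have "\<dots> \<le> card (cobelow S x)"
    by (rule card_mono) (use set in \<open>auto simp: cobelow_def\<close>)
  finally show ?thesis
    using gap_count_False_le order.trans by blast
qed

section \<open>Filling the gaps\<close>

text \<open>Greedy choice by increasing bound: the earlier choices cannot exhaust the candidates
  below the current bound.\<close>

lemma Hall_initial_segments:
  fixes f :: "'i \<Rightarrow> 'a :: linorder"
  assumes "finite I"
    and "\<And>x. finite (C \<inter> {..x})"
    and "\<And>x. x \<in> f ` I \<Longrightarrow> card {i \<in> I. f i \<le> x} \<le> card (C \<inter> {..x})"
  shows "\<exists>v. inj_on v I \<and> (\<forall>i \<in> I. v i \<in> C \<and> v i \<le> f i)"
  using assms(1,3)
proof (induction rule: finite_ranking_induct[where f = f])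
  case empty
  show ?case by simp
next
  case (insert j I)
  show ?case
  proof (cases "j \<in> I")
    case True
    then show ?thesis
      using insert by (simp add: insert_absorb)
  next
    case False
    have "card {i \<in> I. f i \<le> x} \<le> card (C \<inter> {..x})" if "x \<in> f ` I" for x
    proof -
      have "card {i \<in> I. f i \<le> x} \<le> card {i \<in> insert j I. f i \<le> x}"
        by (rule card_mono) (use insert.hyps in auto)
      then show ?thesis
        using insert.prems[of x] that by force
    qed
    then obtain v where v: "inj_on v I" "\<forall>i \<in> I. v i \<in> C \<and> v i \<le> f i"
      using insert.IH by blast
    \<comment> \<open>The ranking induction adds \<open>j\<close> with the largest bound, so the
      condition at \<open>f j\<close> counts every index.\<close>
    have "{i \<in> insert j I. f i \<le> f j} = insert j I"
      using insert.hyps by auto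
    then have "card (insert j I) \<le> card (C \<inter> {..f j})"
      using insert.prems[of "f j"] by simp
    then have "card (v ` I) < card (C \<inter> {..f j})"
      using v(1) False insert.hyps(1) by (simp add: card_image)
    then obtain c where "c \<in> C" "c \<le> f j" "c \<notin> v ` I"
      using card_mono[of "v ` I" "C \<inter> {..f j}"] insert.hyps(1) by force
    then have "inj_on (v(j := c)) (insert j I) \<and>
        (\<forall>i \<in> insert j I. (v(j := c)) i \<in> C \<and> (v(j := c)) i \<le> f i)"
      using v False by (auto simp: inj_on_def)
    then show ?thesis
      by (rule exI[of _ "v(j := c)"])
  qed
qed

text \<open>The parameter \<open>c\<close> stands for the pinnacle before \<open>A\<close>. Starting
  with \<open>c = hd A\<close> bounds the left outer gap by its only neighbour.\<close>

fun gap_bounds :: "nat \<Rightarrow> nat list \<Rightarrow> nat list" where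
  "gap_bounds c [] = [c]"
| "gap_bounds c (s # A) = min c s # gap_bounds s A"

lemma set_gap_bounds: "set (gap_bounds c A) \<subseteq> insert c (set A)"
  by (induction A arbitrary: c) (auto simp: min_def)

lemma length_filter_gap_bounds:
  "length (filter (\<lambda>b. b \<le> x) (gap_bounds c A)) = gap_count (\<lambda>s. s \<le> x) (c \<le> x) A"
  by (induction A arbitrary: c) (auto simp: min_le_iff_disj)

lemma ex_gap_elements:
  assumes "A \<noteq> []"
    and "\<And>x. x \<in> set A \<Longrightarrow> gap_count (\<lambda>s. s \<le> x) False A \<le> card (C \<inter> {..x})"
  shows "\<exists>vs. distinct vs \<and> set vs \<subseteq> C \<and> list_all2 (\<le>) vs (gap_bounds (hd A) A)"
proof -
  let ?b = "gap_bounds (hd A) A"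
  have "card {i \<in> {..<length ?b}. ?b ! i \<le> x} \<le> card (C \<inter> {..x})"
    if x: "x \<in> (!) ?b ` {..<length ?b}" for x
  proof -
    have "x \<in> set ?b"
      using x by auto
    then have "x \<in> set A"
      using assms(1) set_gap_bounds[of "hd A" A] by auto
    \<comment> \<open>The first gap already counts if \<open>hd A \<le> x\<close>, so the flag adds
      nothing.\<close>
    moreover have "gap_count (\<lambda>s. s \<le> x) (hd A \<le> x) A = gap_count (\<lambda>s. s \<le> x) False A"
      using assms(1) by (cases A) auto
    ultimately have "length (filter (\<lambda>b. b \<le> x) ?b) \<le> card (C \<inter> {..x})"
      using assms(2) by (simp add: length_filter_gap_bounds)
    then show ?thesis
      by (simp add: length_filter_conv_card)
  qed
  then obtain v where v: "inj_on v {..<length ?b}" "\<forall>i \<in> {..<length ?b}. v i \<in> C \<and> v i \<le> ?b ! i"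
    using Hall_initial_segments[of "{..<length ?b}" C "(!) ?b"] by blast
  then show ?thesis
    by (intro exI[of _ "map v [0..<length ?b]"])
      (auto simp: distinct_map list_all2_conv_all_nth atLeast0LessThan)
qed

section \<open>Assembling the permutation from the gap elements\<close>

fun interleave :: "'a list \<Rightarrow> 'a list \<Rightarrow> 'a list" where
  "interleave (s # A) (v # vs) = s # v # interleave A vs"
| "interleave _ _ = []"

lemma mset_interleave:
  "length A = length vs \<Longrightarrow> mset (interleave A vs) = mset A + mset vs"
  by (induction A vs rule: list_induct2) auto

lemma filter_interleave:
  assumes "length A = length vs" and "\<forall>s \<in> set A. P s" and "\<forall>v \<in> set vs. \<not> P v"
  shows "filter P (interleave A vs) = A"
  using assms by (induction A vs rule: list_induct2) auto

lemma length_gap_bounds: "length (gap_bounds c A) = Suc (length A)"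
  by (induction A arbitrary: c) auto

text \<open>Disjointness makes the bounds strict, so each letter of \<open>A\<close> exceeds both
  neighbours. The letter \<open>u\<close> will be the end of the decreasing prefix, taking the place
  of \<open>v\<close> in the first gap.\<close>

lemma Pin_interleave:
  assumes "list_all2 (\<le>) (v # vs) (gap_bounds c A)" and "set (v # vs) \<inter> set A = {}" and "u \<le> v"
  shows "Pin (u # interleave A vs) = set A"
  using assms
proof (induction A arbitrary: u v vs c)
  case Nil
  then show ?case by (simp add: Pin_singleton)
next
  case (Cons s A)
  obtain v' vs' where vs: "vs = v' # vs'"
    using Cons.prems(1) length_gap_bounds[of s A] by (cases vs) (auto dest: list_all2_lengthD)
  \<comment> \<open>The next bound is \<open>s\<close> or a minimum with \<open>s\<close>.\<close>
  have "v' \<le> s"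
    using Cons.prems(1) vs by (cases A) auto
  then have less: "u < s" "v' < s"
    using Cons.prems vs by auto
  have "Pin (v' # interleave A vs') = set A"
    by (rule Cons.IH) (use Cons.prems vs in auto)
  then show ?case
    using less vs by (simp add: Pin_Cons2)
qed

text \<open>No letter entered by a descent is a pinnacle.\<close>

lemma Pin_decreasing_append:
  assumes "sorted_wrt (>) (d @ [u])"
  shows "Pin (d @ u # w) = Pin (u # w)"
  using assms
proof (induction d)
  case (Cons a d)
  then show ?case
    by (cases d) (auto simp: Pin_Cons2)
qed simp

lemma admissible_orderingI:
  assumes "finite S" and "0 \<notin> S" and set: "set A = S" and dist: "distinct A"
    and vs: "distinct (v # vs)" "set (v # vs) \<inter> S = {}" "0 \<notin> set (v # vs)"
    and bounds: "list_all2 (\<le>) (v # vs) (gap_bounds c A)"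
  shows "admissible_ordering S A"
proof -
  define n where "n = Max (S \<union> set (v # vs))"
  have le_n: "y \<le> n" if "y \<in> S \<union> set (v # vs)" for y
    unfolding n_def by (rule Max_ge) (use assms(1) that in auto)
  have ge_1: "1 \<le> y" if "y \<in> S \<union> set (v # vs)" for y
    using that assms(2) vs(3) by (cases y) auto
  \<comment> \<open>All non-pinnacles outside the later gaps, \<open>v\<close> included; they form
    the decreasing prefix.\<close>
  define D where "D = {1..n} - S - set vs"
  have "v \<in> D"
    using le_n[of v] ge_1[of v] vs by (auto simp: D_def)
  have "finite D"
    by (simp add: D_def)
  define us where "us = rev (sorted_list_of_set D)"
  have us: "set us = D" "distinct us" "sorted_wrt (>) us"
    using \<open>finite D\<close> strict_sorted_list_of_set[of D] by (auto simp: us_def sorted_wrt_rev)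
  define d u where "d = butlast us" and "u = last us"
  have "us \<noteq> []"
    using us(1) \<open>v \<in> D\<close> by auto
  then have us_eq: "us = d @ [u]"
    by (simp add: d_def u_def)
  \<comment> \<open>The last letter \<open>u\<close> is the least element of
    \<open>D\<close>.\<close>
  then have "u \<le> v"
    using us \<open>v \<in> D\<close> by (auto simp: sorted_wrt_append)
  have len: "length A = length vs"
    using list_all2_lengthD[OF bounds] by (simp add: length_gap_bounds)
  define w where "w = us @ interleave A vs"
  have "Pin w = Pin (u # interleave A vs)"
    using Pin_decreasing_append[of d u] us us_eq by (simp add: w_def)
  also have "\<dots> = S"
    using Pin_interleave[OF bounds _ \<open>u \<le> v\<close>] vs set by simp
  finally have Pin: "Pin w = S" .
  have mset: "mset w = mset us + mset A + mset vs"
    by (simp add: w_def mset_interleave[OF len])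
  have "set w = set_mset (mset us + mset A + mset vs)"
    by (simp flip: mset)
  also have "\<dots> = D \<union> S \<union> set vs"
    by (simp add: us set)
  also have "\<dots> = {1..n}"
    using le_n ge_1 by (auto simp: D_def)
  finally have set_w: "set w = {1..n}" .
  have "distinct (us @ A @ vs)"
    using us dist vs set by (auto simp: D_def)
  then have "distinct w"
    by (rule mset_eq_imp_distinct_iff[THEN iffD1, rotated]) (simp add: mset)
  then have "w \<in> permutations_of_set {1..n}"
    using set_w by (simp add: permutations_of_set_def)
  moreover have "filter (\<lambda>y. y \<in> S) us = []"
    using us by (auto simp: filter_empty_conv D_def)
  then have "filter (\<lambda>y. y \<in> Pin w) w = A"
    unfolding Pin using filter_interleave[OF len, of "\<lambda>y. y \<in> S"] set vs by (auto simp: w_def)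
  ultimately show ?thesis
    using Pin unfolding admissible_ordering_def by blast
qed

theorem theorem3p6:
  fixes S :: "nat set" and A :: "nat list"
  assumes "admissible_pinnacle_set S"
    and "A \<in> permutations_of_set S"
  shows "admissible_ordering S A \<longleftrightarrow>
    (\<forall>x \<in> S. interrupted_at_most (below S x) A (k_bound S x))"
proof -
  have set: "set A = S" and dist: "distinct A"
    using assms(2) by (auto simp: permutations_of_set_def)
  have "0 \<notin> S"
    using assms(1) Pin_subset_set
    by (fastforce simp: admissible_pinnacle_set_def permutations_of_set_def)
  have "admissible_ordering S A \<longleftrightarrow>
    (\<forall>x \<in> S. gap_count (\<lambda>s. s \<le> x) False A \<le> card (cobelow S x))" (is "_ \<longleftrightarrow> ?gaps")
  proof
    assume "admissible_ordering S A"
    then show ?gaps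
      using gap_count_le_card_cobelow unfolding admissible_ordering_def by fastforce
  next
    assume gaps: ?gaps
    show "admissible_ordering S A"
    proof (cases "A = []")
      case True
      \<comment> \<open>Here \<open>S\<close> is empty, and the empty word with \<open>n = 0\<close>
        is a witness.\<close>
      then show ?thesis
        unfolding admissible_ordering_def using set
        by (intro exI[of _ 0] bexI[of _ "[]"]) (auto simp: Pin_def)
    next
      case False
      \<comment> \<open>Gap elements are drawn from the whole complement; \<open>n\<close> is chosen
        only afterwards.\<close>
      have "cobelow S x = ({1..} - S) \<inter> {..x}" for x
        by (auto simp: cobelow_def)
      then obtain vs where vs: "distinct vs" "set vs \<subseteq> {1..} - S"
        "list_all2 (\<le>) vs (gap_bounds (hd A) A)"
        using ex_gap_elements[OF False, of "{1..} - S"] gaps set by auto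
      moreover obtain v vs' where "vs = v # vs'"
        using vs(3) length_gap_bounds[of "hd A" A] by (cases vs) (auto dest: list_all2_lengthD)
      ultimately show ?thesis
        using \<open>0 \<notin> S\<close> set dist by (intro admissible_orderingI) auto
    qed
  qed
  also have "\<dots> \<longleftrightarrow> (\<forall>x \<in> S. interrupted_at_most (below S x) A (k_bound S x))"
    using interrupted_iff_gap_count[OF \<open>0 \<notin> S\<close> assms(2)] by simp
  finally show ?thesis .
qed

end
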